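(* Let $n,k$ be positive integers with $k\le\lceil n/2\rceil$. Then $K_n$ has a balanced Gallai $k$-coloring.
   Context: A Gallai $k$-coloring of the complete graph $K_n$ is an assignment of one of the colors $1,\dots,k$ to each edge of $K_n$ (adjacent edges may have the same color) such that no triangle has its three edges colored with three pairwise different colors. Let the numbers of edges in the $k$ color classes, listed in non-increasing order, be $e_1\ge e_2\ge\dots\ge e_k$ (so $\sum_{i=1}^k e_i=\binom{n}{2}$). The coloring is called balanced if $e_1-e_k\le 1$. *)

theory Defs
  imports Complex_Main "HOL-Library.Ramsey" "HOL-Library.FuncSet"
begin

definition complete_edges :: "nat \<Rightarrow> nat set set" where
  "complete_edges n = nsets {1..n} 2"

(* Only the values of c on complete_edges n matter. *)
definition gallai_coloring :: "nat \<Rightarrow> nat \<Rightarrow> (nat set \<Rightarrow> nat) \<Rightarrow> bool" where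
  "gallai_coloring n k c \<longleftrightarrow>
     c \<in> complete_edges n \<rightarrow> {1..k} \<and>
     (\<forall>x\<in>{1..n}. \<forall>y\<in>{1..n}. \<forall>z\<in>{1..n}. x \<noteq> y \<longrightarrow> y \<noteq> z \<longrightarrow> x \<noteq> z \<longrightarrow>
        \<not> (c {x, y} \<noteq> c {y, z} \<and> c {y, z} \<noteq> c {x, z} \<and> c {x, y} \<noteq> c {x, z}))"

definition color_class :: "nat \<Rightarrow> (nat set \<Rightarrow> nat) \<Rightarrow> nat \<Rightarrow> nat set set" where
  "color_class n c i = {e \<in> complete_edges n. c e = i}"

(* The list [e_1, ..., e_k] with e_1 \<ge> ... \<ge> e_k; colors that are not used contribute 0. *)
definition class_sizes :: "nat \<Rightarrow> nat \<Rightarrow> (nat set \<Rightarrow> nat) \<Rightarrow> nat list" where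
  "class_sizes n k c = rev (sort (map (\<lambda>i. card (color_class n c i)) [1..<Suc k]))"

(* The subtraction does not truncate, as the list is non-increasing.
   Meaningful for k \<ge> 1 only, since the list has length k. *)
definition balanced_coloring :: "nat \<Rightarrow> nat \<Rightarrow> (nat set \<Rightarrow> nat) \<Rightarrow> bool" where
  "balanced_coloring n k c \<longleftrightarrow> hd (class_sizes n k c) - last (class_sizes n k c) \<le> 1"

end

theory Submission
  imports Defs
begin

text \<open>
  Colour an edge by a function of its larger endpoint only. In every triangle the two edges at the
  largest vertex then agree, so the colouring is Gallai, and the vertex \<open>x + 1\<close> contributes \<open>x\<close>
  edges to its colour. It remains to split \<open>{0, \<dots>, n - 1}\<close> into \<open>k\<close> parts whose sums differ by at
  most one. If the required sums are at least \<open>2n - 2\<close>, the largest \<open>2k\<close> numbers are split into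
  \<open>k\<close> pairs of equal sum, which reduces the problem to \<open>n - 2k\<close>. Otherwise the interval from
  \<open>s + 1 - n\<close> to \<open>n - 1\<close> consists of pairs of sum \<open>s\<close>, apart from the midpoint \<open>s / 2\<close> if
  \<open>s\<close> is even. For the odd one of the two required sums there is no midpoint, so if that sum is
  required often enough, taking all these pairs leaves a shorter interval. If it is not, its pairs
  are nested inside pairs of the even sum; a single number of the interval stays unused, and it
  goes to a part that collects everything left over at the end. All other remaining sums are then
  equal, and equal sums can be packed by a similar induction.
\<close>

section \<open>Partial assignments of numbers to parts with prescribed sums\<close>

definition packs :: "nat set \<Rightarrow> (nat \<Rightarrow> nat) \<Rightarrow> bool" where
  "packs X t \<longleftrightarrow> (\<exists>f :: nat \<Rightarrow> nat option. \<forall>i. \<Sum>{x \<in> X. f x = Some i} = t i)"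

text \<open>Demands are written as sums of such functions, so that \<open>packs_add\<close> can
  serve one label in several stages.\<close>

definition const_on :: "nat set \<Rightarrow> nat \<Rightarrow> nat \<Rightarrow> nat" where
  "const_on I s = (\<lambda>i. if i \<in> I then s else 0)"

lemma const_on_empty [simp]: "const_on {} s = (\<lambda>i. 0)"
  by (simp add: const_on_def)

lemma const_on_zero [simp]: "const_on I 0 = (\<lambda>i. 0)"
  by (simp add: const_on_def)

lemma const_on_Diff: "P \<subseteq> I \<Longrightarrow> const_on P s i + const_on (I - P) s i = const_on I s i"
  by (auto simp: const_on_def)

lemma packs_zero: "packs X (\<lambda>i. 0)"
  unfolding packs_def by (rule exI[of _ "\<lambda>_. None"]) simp

lemma packs_mono:
  assumes "packs X t" "X \<subseteq> Y"
  shows "packs Y t"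
proof -
  obtain f where f: "\<And>i. \<Sum>{x \<in> X. f x = Some i} = t i"
    using assms(1) unfolding packs_def by blast
  have "{x \<in> Y. (if x \<in> X then f x else None) = Some i} = {x \<in> X. f x = Some i}" for i
    using assms(2) by (auto split: if_splits)
  then show ?thesis
    unfolding packs_def using f by (intro exI[of _ "\<lambda>x. if x \<in> X then f x else None"]) simp
qed

lemma packs_add:
  assumes "packs X t" "packs Y u" "X \<inter> Y = {}" "finite X" "finite Y"
  shows "packs (X \<union> Y) (\<lambda>i. t i + u i)"
proof -
  obtain f where f: "\<And>i. \<Sum>{x \<in> X. f x = Some i} = t i"
    using assms(1) unfolding packs_def by blast
  obtain g where g: "\<And>i. \<Sum>{x \<in> Y. g x = Some i} = u i"
    using assms(2) unfolding packs_def by blast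
  define h where "h x = (if x \<in> X then f x else g x)" for x
  have "{x \<in> X \<union> Y. h x = Some i} = {x \<in> X. f x = Some i} \<union> {x \<in> Y. g x = Some i}" for i
    using assms(3) by (auto simp: h_def)
  moreover have "\<Sum>({x \<in> X. f x = Some i} \<union> {x \<in> Y. g x = Some i}) = t i + u i" for i
    using assms(3-5) f g by (subst sum.union_disjoint) auto
  ultimately show ?thesis
    unfolding packs_def by (intro exI[of _ h]) simp
qed

lemma packs_single: "finite S \<Longrightarrow> packs S (const_on {i} (\<Sum>S))"
  unfolding packs_def const_on_def by (rule exI[of _ "\<lambda>_. Some i"]) auto

text \<open>The numbers \<open>l + j\<close> and \<open>r + c - 1 - j\<close> have the constant sum
  \<open>d\<close>; the induction peels off the outermost pair.\<close>

lemma packs_pairs: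
  assumes "finite I" "card I = c" "l + c \<le> r" "d + 1 = l + r + c"
  shows "packs ({l..<l + c} \<union> {r..<r + c}) (const_on I d)"
  using assms
proof (induction c arbitrary: I l)
  case 0
  then show ?case by (simp add: const_on_def packs_zero)
next
  case (Suc c)
  then obtain i J where i: "I = insert i J" "i \<notin> J" "card J = c"
    by (metis card_Suc_eq)
  have fin: "finite J" using Suc.prems(1) i by simp
  have 1: "packs ({Suc l..<Suc l + c} \<union> {r..<r + c}) (const_on J d)"
    using Suc.prems fin i by (intro Suc.IH) auto
  have 2: "packs {l, r + c} (const_on {i} d)"
  proof -
    have "\<Sum>{l, r + c} = d" using Suc.prems by simp
    then show ?thesis using packs_single[of "{l, r + c}" i] by simp
  qed
  have "packs (({Suc l..<Suc l + c} \<union> {r..<r + c}) \<union> {l, r + c})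
          (\<lambda>j. const_on J d j + const_on {i} d j)"
    using Suc.prems by (intro packs_add 1 2) auto
  moreover have "(\<lambda>j. const_on J d j + const_on {i} d j) = const_on I d"
    using i by (auto simp: const_on_def)
  moreover have "({Suc l..<Suc l + c} \<union> {r..<r + c}) \<union> {l, r + c}
      = {l..<l + Suc c} \<union> {r..<r + Suc c}"
    by auto
  ultimately show ?case by simp
qed

text \<open>Whatever no other label of \<open>I\<close> claims goes to \<open>r\<close>, whose sum
  is then forced by the total.\<close>

lemma packs_fill:
  assumes "packs X u" "finite X" "finite I" "r \<in> I"
    and eq: "\<And>i. i \<in> I - {r} \<Longrightarrow> u i = t i" and total: "sum t I = \<Sum>X"
  shows "\<exists>g \<in> X \<rightarrow> I. \<forall>i \<in> I. \<Sum>{x \<in> X. g x = i} = t i"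
proof -
  obtain f where f: "\<And>i. \<Sum>{x \<in> X. f x = Some i} = u i"
    using assms(1) unfolding packs_def by blast
  define g where "g x = (case f x of Some i \<Rightarrow> (if i \<in> I then i else r) | None \<Rightarrow> r)" for x
  have gI: "g \<in> X \<rightarrow> I"
    using \<open>r \<in> I\<close> by (auto simp: g_def split: option.split)
  have g1: "\<Sum>{x \<in> X. g x = i} = t i" if "i \<in> I - {r}" for i
  proof -
    have "{x \<in> X. g x = i} = {x \<in> X. f x = Some i}"
      using that by (auto simp: g_def split: option.splits if_splits)
    then show ?thesis using f eq that by simp
  qed
  have "(\<Sum>i \<in> I. \<Sum>{x \<in> X. g x = i}) = \<Sum>X"
    using gI assms(2,3) by (intro sum.group) auto
  then have "\<Sum>{x \<in> X. g x = r} + (\<Sum>i \<in> I - {r}. \<Sum>{x \<in> X. g x = i})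
      = t r + sum t (I - {r})"
    using total assms(3,4) by (simp add: sum.remove[of I r])
  moreover have "(\<Sum>i \<in> I - {r}. \<Sum>{x \<in> X. g x = i}) = sum t (I - {r})"
    using g1 by (intro sum.cong) auto
  ultimately have "\<Sum>{x \<in> X. g x = r} = t r"
    by simp
  with g1 gI show ?thesis by blast
qed

lemma packs_complete:
  assumes "packs X u" "finite X" "finite I" "r \<in> I"
    and "\<And>i. i \<in> I - {r} \<Longrightarrow> u i = t i" and "sum t I = \<Sum>X" and "\<And>i. i \<notin> I \<Longrightarrow> t i = 0"
  shows "packs X t"
proof -
  obtain g where g: "g \<in> X \<rightarrow> I" "\<And>i. i \<in> I \<Longrightarrow> \<Sum>{x \<in> X. g x = i} = t i"
    using packs_fill[OF assms(1-6)] by blast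
  have "\<Sum>{x \<in> X. Some (g x) = Some i} = t i" for i
  proof (cases "i \<in> I")
    case False
    then have "{x \<in> X. Some (g x) = Some i} = {}" using g(1) by auto
    then show ?thesis using assms(7)[OF False] by (simp only: sum.empty)
  qed (use g in simp)
  then show ?thesis
    unfolding packs_def by (intro exI[of _ "\<lambda>x. Some (g x)"]) blast
qed

lemma double_sum_lessThan: "2 * \<Sum>{..<n} + n = n * n" for n :: nat
  by (induction n) (auto simp: lessThan_Suc)

section \<open>Packing equal sums\<close>

text \<open>
  The set \<open>H\<close> accommodates the midpoint \<open>s / 2\<close>: a part started with this midpoint still needs
  \<open>s / 2\<close>. Removing the top \<open>2 * card I + 1\<close> numbers as pairs around a middle \<open>f\<close> lowers \<open>s\<close> by
  \<open>2 * f\<close> and the half by \<open>f\<close>, so the deficient part keeps needing exactly one half, and the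
  next midpoint completes it.
\<close>

lemma packs_equal:
  assumes "finite I" "card H \<le> 1" "finite H" "H \<noteq> {} \<Longrightarrow> even s" "n \<le> s + 1"
    and "(2 * card I + card H) * s + n \<le> n * n"
  shows "packs {..<n} (\<lambda>i. const_on I s i + const_on H (s div 2) i)"
  using assms
proof (induction n arbitrary: I H s rule: less_induct)
  case (less n)
  \<comment> \<open>\<open>w * s\<close> is twice the total demand; \<open>w\<close> numbers provide
    a pair for each label of \<open>I\<close> and a midpoint for \<open>H\<close>.\<close>
  define w where "w = 2 * card I + card H"
  consider "s = 0" | "w = 0" | "s > 0" "w > 0" "s + 2 \<le> 2 * n" "odd s"
    | "s > 0" "w > 0" "s + 2 \<le> 2 * n" "even s" | "s > 0" "w > 0" "2 * n \<le> s + 1"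
    by linarith
  then show ?case
  proof cases
    case 1
    then show ?thesis by (simp add: packs_zero)
  next
    case 2
    then have "I = {}" "H = {}" using less.prems by (auto simp: w_def)
    then show ?thesis by (simp add: packs_zero)
  next
    case 3
    then have H: "H = {}" using less.prems by auto
    obtain g where g: "s = 2 * g + 1" using 3 by (auto elim: oddE)
    \<comment> \<open>The pairs \<open>{x, s - x}\<close> below \<open>n\<close> have
      \<open>x\<close> running from \<open>s + 1 - n\<close> to \<open>g\<close>, which makes
      \<open>p\<close> pairs.\<close>
    define p where "p = n - 1 - g"
    show ?thesis
    proof (cases "card I \<le> p")
      case True
      have "packs ({2 * g + 2 - n..<2 * g + 2 - n + card I} \<union> {n - card I..<n - card I + card I})
          (const_on I s)"
        using less.prems 3 g True by (intro packs_pairs) (auto simp: p_def)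
      then show ?thesis
        using H True 3 g by (auto elim!: packs_mono simp: p_def)
    next
      case False
      then obtain P where P: "P \<subseteq> I" "card P = p" "finite P"
        by (metis nat_le_linear obtain_subset_with_card_n)
      define m where "m = s + 1 - n"
      define q where "q = card (I - P)"
      have cI: "card I = p + q"
        using P less.prems(1) False by (simp add: q_def card_Diff_subset)
      have np: "n = p + 1 + g" "m = 2 * g + 2 - n" "n + m = 2 * g + 2"
        using 3 g less.prems by (auto simp: p_def m_def)
      have A: "packs ({m..<m + p} \<union> {m + p..<m + p + p}) (const_on P s)"
        using P np g less.prems by (intro packs_pairs) auto
      have "2 * q * s + m \<le> m * m"
      proof -
        have "(2 * (p + q)) * s + n \<le> n * n"
          using less.prems(6) cI H by simp
        then have "int ((2 * (p + q)) * s + n) \<le> int (n * n)"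
          by (simp only: of_nat_le_iff)
        \<comment> \<open>Both sides are twice the sum of the interval from \<open>m\<close> to
          \<open>n - 1\<close>, so supply and demand drop equally.\<close>
        moreover have "2 * int p * int s = (int n - int m) * (int n + int m - 1)"
        proof -
          have "int s = int n + int m - 1" "2 * int p = int n - int m"
            using np g by auto
          then show ?thesis by simp
        qed
        ultimately have "int (2 * q * s + m) \<le> int (m * m)"
          by (simp add: algebra_simps)
        then show ?thesis by (simp only: of_nat_le_iff)
      qed
      then have B: "packs {..<m} (const_on (I - P) s)"
        using less.IH[of m "I - P" "{}" s] less.prems 3 np by (simp add: q_def m_def)
      have "packs (({m..<m + p} \<union> {m + p..<m + p + p}) \<union> {..<m})
          (\<lambda>i. const_on P s i + const_on (I - P) s i)"
        by (intro packs_add A B) auto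
      moreover have "({m..<m + p} \<union> {m + p..<m + p + p}) \<union> {..<m} \<subseteq> {..<n}"
        using np by auto
      ultimately show ?thesis
        using H P(1) by (auto elim!: packs_mono simp: const_on_Diff)
    qed
  next
    case 4
    then obtain f where f: "s = 2 * f" by (auto elim: evenE)
    define p where "p = n - 1 - f"
    define m where "m = s + 1 - n"
    have np: "n = p + 1 + f" "m + n = 2 * f + 1" "m + p = f"
      using 4 f less.prems by (auto simp: p_def m_def)
    have mid: "packs {f} (const_on J f)" if "card J \<le> 1" "finite J" for J
    proof (cases "J = {}")
      case False
      then have "card J = 1" using that by (simp add: le_Suc_eq)
      then obtain i where "J = {i}" by (auto simp: card_1_singleton_iff)
      then show ?thesis using packs_single[of "{f}" i] by simp
    qed (simp add: packs_zero const_on_def)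
    show ?thesis
    proof (cases "card I \<le> p")
      case True
      have A: "packs ({m..<m + card I} \<union> {n - card I..<n - card I + card I}) (const_on I s)"
        using less.prems np f True by (intro packs_pairs) auto
      have "packs (({m..<m + card I} \<union> {n - card I..<n - card I + card I}) \<union> {f})
          (\<lambda>i. const_on I s i + const_on H f i)"
        using less.prems np f True by (intro packs_add A mid) auto
      moreover have "({m..<m + card I} \<union> {n - card I..<n - card I + card I}) \<union> {f} \<subseteq> {..<n}"
        using np True by auto
      ultimately show ?thesis
        using f by (auto elim!: packs_mono)
    next
      case False
      then obtain P where P: "P \<subseteq> I" "card P = p" "finite P"
        by (metis nat_le_linear obtain_subset_with_card_n)
      define q where "q = card (I - P)"
      have cI: "card I = p + q" and q: "q > 0"
        using P less.prems(1) False by (simp_all add: q_def card_Diff_subset)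
      have A: "packs ({m..<m + p} \<union> {n - p..<n - p + p}) (const_on P s)"
        using P np f less.prems by (intro packs_pairs) auto
      \<comment> \<open>Pairs and midpoint leave the supply, but only the pairs are subtracted from
        the demand; the midpoint, doubled, is the extra \<open>s\<close>.\<close>
      have est: "(2 * q + card H) * s + m \<le> m * m + s"
      proof -
        have "(2 * (p + q) + card H) * s + n \<le> n * n"
          using less.prems(6) cI by simp
        then have "int ((2 * (p + q) + card H) * s + n) \<le> int (n * n)"
          by (simp only: of_nat_le_iff)
        moreover have "2 * int p * int s = (int n - int m - 1) * (int n + int m - 1)"
        proof -
          have "int s = int n + int m - 1" "2 * int p = int n - int m - 1"
            using np f by auto
          then show ?thesis by simp
        qed
        moreover have "int n + int m \<le> int s + 1"
          using np f by auto
        ultimately have "int ((2 * q + card H) * s + m) \<le> int (m * m + s)"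
          by (simp add: algebra_simps)
        then show ?thesis by (simp only: of_nat_le_iff)
      qed
      have fin: "finite (I - P)" using less.prems(1) by simp
      have mn: "m < n" "m \<le> s + 1" using np 4 f by (auto simp: m_def)
      show ?thesis
      proof (cases "H = {}")
        case True
        obtain r where r: "r \<in> I - P"
          using q by (metis card.empty equals0I less_numeral_extra(3) q_def)
        have cr: "card (I - P - {r}) + 1 = q"
          using r fin q by (simp add: q_def)
        have B: "packs {..<m} (\<lambda>i. const_on (I - P - {r}) s i + const_on {r} (s div 2) i)"
        proof (rule less.IH[OF mn(1)])
          have "2 * card (I - P - {r}) + 1 + 1 = 2 * q" using cr by simp
          then have "(2 * card (I - P - {r}) + 1) * s + s = 2 * q * s"
            by (metis add_mult_distrib mult_1)
          then show "(2 * card (I - P - {r}) + card {r}) * s + m \<le> m * m"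
            using est True by simp
        qed (use fin f mn in auto)
        have "packs ((({m..<m + p} \<union> {n - p..<n - p + p}) \<union> {f}) \<union> {..<m})
            (\<lambda>i. const_on P s i + const_on {r} f i
              + (const_on (I - P - {r}) s i + const_on {r} (s div 2) i))"
          using np by (intro packs_add A B mid) auto
        moreover have "const_on P s i + const_on {r} f i
              + (const_on (I - P - {r}) s i + const_on {r} (s div 2) i) = const_on I s i" for i
          using P(1) r f by (auto simp: const_on_def)
        moreover have "(({m..<m + p} \<union> {n - p..<n - p + p}) \<union> {f}) \<union> {..<m} \<subseteq> {..<n}"
          using np by auto
        ultimately show ?thesis
          using True by (auto elim!: packs_mono)
      next
        case False
        then have cH: "card H = 1"
          using less.prems(2,3) by (simp add: le_Suc_eq)
        have B: "packs {..<m} (\<lambda>i. const_on (I - P) s i + const_on {} (s div 2) i)"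
        proof (rule less.IH[OF mn(1)])
          show "(2 * card (I - P) + card {}) * s + m \<le> m * m"
            using est cH by (simp add: algebra_simps q_def)
        qed (use fin f mn in auto)
        have "packs ((({m..<m + p} \<union> {n - p..<n - p + p}) \<union> {f}) \<union> {..<m})
            (\<lambda>i. const_on P s i + const_on H f i
              + (const_on (I - P) s i + const_on {} (s div 2) i))"
          using np less.prems by (intro packs_add A B mid) auto
        moreover have "const_on P s i + const_on H f i
              + (const_on (I - P) s i + const_on {} (s div 2) i)
            = const_on I s i + const_on H (s div 2) i" for i
          using P(1) f by (auto simp: const_on_def)
        moreover have "(({m..<m + p} \<union> {n - p..<n - p + p}) \<union> {f}) \<union> {..<m} \<subseteq> {..<n}"
          using np by auto
        ultimately show ?thesis
          by (auto elim!: packs_mono)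
      qed
    qed
  next
    case 5
    \<comment> \<open>Since \<open>s \<ge> 2 * n - 1\<close>, having \<open>w \<ge> n\<close> would
      make twice the demand exceed \<open>n * n - n\<close>.\<close>
    have wn: "w < n"
    proof (rule ccontr)
      assume "\<not> w < n"
      then have "n * s \<le> w * s" by simp
      moreover have "2 * (n * n) \<le> n * s + n"
        using mult_le_mono2[OF 5(3), of n] by (simp add: algebra_simps)
      moreover have nn: "w * s + n \<le> n * n" using less.prems(6) by (simp add: w_def)
      moreover have "0 < n * n" using 5 nn by (cases n) auto
      ultimately show False by linarith
    qed
    \<comment> \<open>\<open>d\<close> is the sum of the least and the greatest of the top
      \<open>w\<close> numbers. These form pairs of sum \<open>d\<close>, with middle
      \<open>d div 2\<close> if \<open>H\<close> is nonempty; \<open>t\<close> is what remains of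
      \<open>s\<close>.\<close>
    define d where "d = 2 * n - 1 - w"
    define t where "t = s - d"
    define m where "m = min (n - w) (t + 1)"
    have d: "d + w + 1 = 2 * n" "s = t + d" "w \<le> t" "0 < d"
      using wn 5 by (auto simp: d_def t_def)
    \<comment> \<open>Only numbers below \<open>t + 1\<close> are kept, since the induction hypothesis needs \<open>m \<le> t + 1\<close>.\<close>
    have B: "packs {..<m} (\<lambda>i. const_on I t i + const_on H (t div 2) i)"
    proof (rule less.IH)
      show "m < n" using 5 wn by (simp add: m_def)
      show "H \<noteq> {} \<Longrightarrow> even t"
      proof -
        assume H: "H \<noteq> {}"
        then have "card H = 1" using less.prems(2,3) by (simp add: le_Suc_eq)
        then have "even (d + w + 1) \<Longrightarrow> even d" by (simp add: w_def)
        then show "even t" using d less.prems(4)[OF H] by (metis dvd_add_left_iff dvd_triv_left)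
      qed
      \<comment> \<open>If \<open>m = n - w\<close>, supply and demand drop by the same amount; if
        \<open>m = t + 1\<close>, the bound \<open>w \<le> t\<close> suffices.\<close>
      have "w * t + m \<le> m * m"
      proof (cases "n - w \<le> t + 1")
        case True
        then have m: "n = m + w" using wn by (simp add: m_def)
        then have "d + 1 = 2 * m + w" using d by simp
        then have "w * d + w = w * (2 * m + w)" by (metis add_mult_distrib2 mult_1_right)
        moreover have "w * t + w * d + n \<le> n * n"
          using less.prems(6) d(2) by (simp add: w_def algebra_simps)
        moreover have "n * n = m * m + w * (2 * m + w)" using m by (simp add: algebra_simps)
        ultimately show ?thesis using m by linarith
      next
        case False
        then have "m = t + 1" by (simp add: m_def)
        moreover have "w * t \<le> t * t + t" using mult_le_mono1[OF d(3), of t] by linarith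
        ultimately show ?thesis by simp
      qed
      then show "(2 * card I + card H) * t + m \<le> m * m" by (simp add: w_def)
    qed (use less.prems in \<open>auto simp: m_def\<close>)
    define l where "l = n - w"
    have A: "packs ({l..<l + card I} \<union> {n - card I..<n - card I + card I}) (const_on I d)"
      using less.prems wn d by (intro packs_pairs) (auto simp: l_def w_def)
    have M: "packs {l + card I..<n - card I} (const_on H (d div 2))"
    proof (cases "H = {}")
      case False
      then have cH: "card H = 1" using less.prems(2,3) by (simp add: le_Suc_eq)
      then obtain j where j: "H = {j}" by (auto simp: card_1_singleton_iff)
      have "n - card I = Suc (l + card I)" "d div 2 = l + card I"
        using cH wn d by (auto simp: l_def w_def)
      then show ?thesis using packs_single[of "{l + card I}" j] j
        by (simp add: atLeastLessThanSuc)
    qed (simp add: packs_zero const_on_def)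
    have "packs ((({l..<l + card I} \<union> {n - card I..<n - card I + card I})
          \<union> {l + card I..<n - card I}) \<union> {..<m})
        (\<lambda>i. const_on I d i + const_on H (d div 2) i + (const_on I t i + const_on H (t div 2) i))"
      using wn by (intro packs_add A B M) (auto simp: l_def m_def w_def)
    moreover have "const_on I d i + const_on H (d div 2) i
        + (const_on I t i + const_on H (t div 2) i) = const_on I s i + const_on H (s div 2) i" for i
    proof -
      have "d div 2 + t div 2 = s div 2" if "i \<in> H"
      proof -
        have "card H = 1" using that less.prems(2,3) by (auto simp: le_Suc_eq)
        then have "even d" using d(1) by (simp add: w_def) presburger
        then show ?thesis using d(2) by auto
      qed
      then show ?thesis using d(2) by (auto simp: const_on_def)
    qed
    moreover have "(({l..<l + card I} \<union> {n - card I..<n - card I + card I})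
          \<union> {l + card I..<n - card I}) \<union> {..<m} \<subseteq> {..<n}"
      using wn by (auto simp: l_def m_def w_def)
    ultimately show ?thesis
      by (auto elim!: packs_mono)
  qed
qed

section \<open>Packing sums that differ by one\<close>

lemma sum_const_on_add:
  assumes "finite A" "finite B" "A \<inter> B = {}"
  shows "(\<Sum>i \<in> A \<union> B. const_on A s i + const_on B t i) = card A * s + card B * t"
proof -
  have "(\<Sum>i \<in> A \<union> B. const_on A s i + const_on B t i)
      = (\<Sum>i \<in> A. const_on A s i + const_on B t i) + (\<Sum>i \<in> B. const_on A s i + const_on B t i)"
    using assms by (intro sum.union_disjoint) auto
  also have "(\<Sum>i \<in> A. const_on A s i + const_on B t i) = (\<Sum>i \<in> A. s)"
    using assms(3) by (intro sum.cong) (auto simp: const_on_def)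
  also have "(\<Sum>i \<in> B. const_on A s i + const_on B t i) = (\<Sum>i \<in> B. t)"
    using assms(3) by (intro sum.cong) (auto simp: const_on_def)
  finally show ?thesis by simp
qed

text \<open>By \<open>few\<close>, at least \<open>card A\<close> pairs of sum \<open>2 * f\<close>
  lie below \<open>n\<close>. The innermost \<open>card A\<close> of them and the midpoint are
  consecutive numbers; dropping one end leaves \<open>card A\<close> pairs of sum \<open>u\<close>.
  Labels of \<open>B\<close> get the outer pairs, and any excess is packed below \<open>m\<close>,
  except for one label \<open>r\<close> that collects the leftovers.\<close>

lemma packs_few_odd:
  assumes fin: "finite A" "finite B" "A \<inter> B = {}"
    and u: "odd u" "u = 2 * f + 1 \<or> u + 1 = 2 * f" "n \<le> u + 1" "n \<le> 2 * f + 1" "f + 1 \<le> n"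
    and total: "2 * (card A * u + card B * (2 * f)) + n = n * n"
    and few: "card A + f + 1 \<le> n"
  shows "packs {..<n} (\<lambda>i. const_on A u i + const_on B (2 * f) i)"
proof -
  define c where "c = card A"
  \<comment> \<open>\<open>k\<close> pairs of sum \<open>2 * f\<close> remain around the inner
    block, and \<open>m\<close> is the partner of \<open>n - 1\<close>.\<close>
  define k where "k = n - 1 - f - c"
  define m where "m = 2 * f + 1 - n"
  \<comment> \<open>The inner pairs start at \<open>l\<close>; the unused number lies directly below them if \<open>u = 2 * f + 1\<close>,
    and directly above them if \<open>u + 1 = 2 * f\<close>.\<close>
  define l where "l = (if u = 2 * f + 1 then m + k + 1 else m + k)"
  have kc: "k + c + f + 1 = n" "m + n = 2 * f + 1"
    using few u by (auto simp: k_def c_def m_def)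
  have inner: "packs ({l..<l + c} \<union> {l + c..<l + c + c}) (const_on A u)"
    using fin u(2) kc by (intro packs_pairs) (auto simp: c_def l_def)
  have outer: "packs ({m..<m + card D} \<union> {n - card D..<n - card D + card D}) (const_on D (2 * f))"
    if "finite D" "card D \<le> k" for D
    using that kc by (intro packs_pairs) auto
  have both: "packs {m..<n} (\<lambda>i. const_on A u i + const_on D (2 * f) i)"
    if "finite D" "card D \<le> k" for D
  proof -
    have "packs (({l..<l + c} \<union> {l + c..<l + c + c})
          \<union> ({m..<m + card D} \<union> {n - card D..<n - card D + card D}))
        (\<lambda>i. const_on A u i + const_on D (2 * f) i)"
      using that kc u(2) by (intro packs_add inner outer) (auto simp: l_def)
    then show ?thesis
      using that kc u(2) by (elim packs_mono) (auto simp: l_def)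
  qed
  show ?thesis
  proof (cases "card B \<le> k")
    case True
    then show ?thesis using both[of B] fin(2) by (auto elim!: packs_mono)
  next
    case False
    then obtain C where C: "C \<subseteq> B" "card C = k" "finite C"
      by (metis nat_le_linear obtain_subset_with_card_n)
    have "card (B - C) > 0"
      using C False fin(2) by (simp add: card_Diff_subset)
    then obtain r where r: "r \<in> B - C"
      by (metis card.empty equals0I less_numeral_extra(3))
    define q where "q = card (B - C - {r})"
    have cB: "card B = k + q + 1"
      using C r fin(2) False by (simp add: q_def card_Diff_subset)
    \<comment> \<open>The interval from \<open>m\<close> to \<open>n - 1\<close> has sum
      \<open>(2 * k + 2 * c + 1) * f\<close>, so the numbers below \<open>m\<close> sum to
      \<open>2 * q * f + f + c * (u - 2 * f)\<close>. This is at least \<open>2 * q * f\<close>, as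
      \<open>c \<le> f\<close> when \<open>u + 1 = 2 * f\<close>.\<close>
    have "2 * q * (2 * f) + m \<le> m * m"
    proof -
      have c: "int c = int n - int f - 1 - int k" and m: "int m = 2 * int f + 1 - int n"
        using kc by auto
      have "int (2 * (c * u + (k + q + 1) * (2 * f)) + n) = int (n * n)"
        using total cB by (simp only: c_def)
      then have *: "2 * (int c * int u + (int k + int q + 1) * (2 * int f)) + int n = int n * int n"
        by (simp add: algebra_simps)
      have "int u * int c \<ge> 2 * int f * int c - int f"
        using u(2)
      proof
        assume "u + 1 = 2 * f"
        then have "int u + 1 = 2 * int f" by linarith
        then have "int c * (int u + 1) = 2 * int f * int c" by simp
        moreover have "c \<le> f" using kc \<open>u + 1 = 2 * f\<close> u(3) by auto
        ultimately show ?thesis by (simp add: distrib_left mult.commute)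
      qed (simp add: algebra_simps)
      with * have "2 * (2 * int f * int c - int f + (int k + int q + 1) * (2 * int f)) + int n \<le> int n * int n"
        by (simp add: algebra_simps)
      then have "int (2 * q * (2 * f) + m) \<le> int (m * m)"
        unfolding of_nat_add of_nat_mult c m by (simp add: algebra_simps)
      then show ?thesis by (simp only: of_nat_le_iff)
    qed
    then have E: "packs {..<m} (const_on (B - C - {r}) (2 * f))"
      using packs_equal[of "B - C - {r}" "{}" "2 * f" m] fin(2) kc by (simp add: q_def)
    have P: "packs ({m..<n} \<union> {..<m})
        (\<lambda>i. const_on A u i + const_on C (2 * f) i + const_on (B - C - {r}) (2 * f) i)"
      using C by (intro packs_add both E) auto
    have un: "{m..<n} \<union> {..<m} = {..<n}" using kc by auto
    show ?thesis
    proof (rule packs_complete[OF P[unfolded un], of "A \<union> B" r])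
      have "2 * (card A * u + card B * (2 * f)) + n = 2 * \<Sum>{..<n} + n"
        using total double_sum_lessThan[of n] by simp
      then show "(\<Sum>i \<in> A \<union> B. const_on A u i + const_on B (2 * f) i) = \<Sum>{..<n}"
        using sum_const_on_add[OF fin] by simp
    qed (use fin r C in \<open>auto simp: const_on_def\<close>)
  qed
qed

text \<open>The total is kept exact through the induction because the case of few odd sums fills its
  last label by difference.\<close>

lemma packs_nearly_equal:
  assumes "finite A" "finite B" "A \<inter> B = {}" "odd u" "even s" "u = s + 1 \<or> s = u + 1"
    and "n \<le> u + 1" "n \<le> s + 1" "2 * (card A * u + card B * s) + n = n * n"
  shows "packs {..<n} (\<lambda>i. const_on A u i + const_on B s i)"
  using assms
proof (induction n arbitrary: A B u s rule: less_induct)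
  case (less n)
  define w where "w = 2 * (card A + card B)"
  obtain f where f: "s = 2 * f" using less.prems(5) by (auto elim: evenE)
  obtain g where g: "u = 2 * g + 1" using less.prems(4) by (auto elim: oddE)
  \<comment> \<open>In order: a trivial interval, few odd sums, enough odd sums to use all their
    pairs, and both sums at least \<open>2 * n - 2\<close>.\<close>
  consider "n \<le> 1" | "f + 1 \<le> n" "card A + f + 1 \<le> n"
    | "f + 1 \<le> n" "g + 2 \<le> n" "n < card A + f + 1" | "2 \<le> n" "2 * n \<le> u + 2" "2 * n \<le> s + 2"
    using f g less.prems(6) by linarith
  then show ?case
  proof cases
    case 1
    then have "n * n = n" by (cases n) auto
    then have "card A * u = 0" "card B * s = 0" using less.prems(9) by auto
    then have "A = {}" "B = {} \<or> s = 0" using less.prems(1,2) g by auto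
    then show ?thesis by (auto simp: packs_zero)
  next
    case 2
    then show ?thesis
      using packs_few_odd[of A B u f n] less.prems f by auto
  next
    case 3
    define p where "p = n - 1 - g"
    define m where "m = 2 * g + 2 - n"
    have np: "n = p + 1 + g" "n + m = 2 * g + 2" "m + p = g + 1"
      using 3 g less.prems(7) by (auto simp: p_def m_def)
    \<comment> \<open>Here \<open>card A \<ge> n - f\<close>, and \<open>g + 1 \<ge> f\<close>
      because the two sums differ by one.\<close>
    have "p \<le> card A" using 3 f g less.prems(6) np by auto
    then obtain P where P: "P \<subseteq> A" "card P = p" "finite P"
      using obtain_subset_with_card_n by metis
    have cA: "card A = p + card (A - P)"
      using P less.prems(1) \<open>p \<le> card A\<close> by (simp add: card_Diff_subset)
    have pairs: "packs ({m..<m + p} \<union> {m + p..<m + p + p}) (const_on P u)"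
      using P np g by (intro packs_pairs) auto
    have rest: "packs {..<m} (\<lambda>i. const_on (A - P) u i + const_on B s i)"
    proof (rule less.IH)
      have "int (2 * ((p + card (A - P)) * u + card B * s) + n) = int (n * n)"
        using less.prems(9) cA by (simp only:)
      moreover have "2 * int p * int u = (int n - int m) * (int n + int m - 1)"
      proof -
        have "int u = int n + int m - 1" "2 * int p = int n - int m"
          using np g by auto
        then show ?thesis by simp
      qed
      ultimately have "int (2 * (card (A - P) * u + card B * s) + m) = int (m * m)"
        by (simp add: algebra_simps)
      then show "2 * (card (A - P) * u + card B * s) + m = m * m"
        by (simp only: of_nat_eq_iff)
    qed (use less.prems np g 3 in \<open>auto simp: m_def\<close>)
    have "packs (({m..<m + p} \<union> {m + p..<m + p + p}) \<union> {..<m})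
        (\<lambda>i. const_on P u i + (const_on (A - P) u i + const_on B s i))"
      by (intro packs_add pairs rest) auto
    moreover have "const_on P u i + (const_on (A - P) u i + const_on B s i)
        = const_on A u i + const_on B s i" for i
      using const_on_Diff[OF P(1), of u i] by simp
    moreover have "({m..<m + p} \<union> {m + p..<m + p + p}) \<union> {..<m} \<subseteq> {..<n}"
      using np by auto
    ultimately show ?thesis
      by (auto elim!: packs_mono)
  next
    case 4
    then obtain j where j: "n = Suc j" "0 < j" by (cases n) auto
    \<comment> \<open>Both sums are at least \<open>2 * j\<close>, so comparison with twice the
      total, \<open>Suc j * j\<close>, yields \<open>2 * w \<le> n\<close>.\<close>
    have "card A * (2 * j) \<le> card A * u" "card B * (2 * j) \<le> card B * s"
      using 4 j by (auto intro!: mult_le_mono2)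
    then have "2 * (card A * (2 * j) + card B * (2 * j)) \<le> 2 * (card A * u + card B * s)"
      by (rule mult_le_mono2[OF add_mono])
    moreover have "2 * w * j = 2 * (card A * (2 * j) + card B * (2 * j))"
      by (simp add: w_def algebra_simps)
    moreover have "2 * (card A * u + card B * s) = Suc j * j"
      using less.prems(9) j by simp
    ultimately have "2 * w * j \<le> Suc j * j"
      by (simp only:)
    then have wn: "2 * w \<le> n" using j by (simp only: mult_le_cancel2)
    have "w \<noteq> 0"
    proof
      assume "w = 0"
      then have "n = n * n" using less.prems(1,2,9) by (auto simp: w_def)
      then show False using 4(1) by simp
    qed
    define d where "d = 2 * n - 1 - w"
    define m where "m = n - w"
    define u' where "u' = u - d"
    define s' where "s' = s - d"
    have d: "d + w + 1 = 2 * n" "u = u' + d" "s = s' + d" "w \<le> u' + 1" "w \<le> s' + 1" "n = m + w"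
      using wn 4 \<open>w \<noteq> 0\<close> by (auto simp: d_def u'_def s'_def m_def)
    have tot: "2 * (card A * u' + card B * s') + m = m * m"
    proof -
      have "int (2 * (card A * (u' + d) + card B * (s' + d)) + n) = int (n * n)"
        using less.prems(9) d(2,3) by (simp only:)
      moreover have "2 * (int (card A) + int (card B)) * int d = int w * (2 * int n - 1 - int w)"
      proof -
        have "int d = 2 * int n - 1 - int w" using d(1) by linarith
        then show ?thesis by (simp add: w_def)
      qed
      moreover have "int n = int m + int w" using d(6) by simp
      ultimately have "int (2 * (card A * u' + card B * s') + m) = int (m * m)"
        by (simp add: algebra_simps)
      then show ?thesis by (simp only: of_nat_eq_iff)
    qed
    \<comment> \<open>Otherwise both reduced sums are at most \<open>m - 1\<close>, and the exact
      total forces \<open>m \<le> w\<close> or \<open>m = 1\<close>, each a contradiction.\<close>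
    have bound: "m \<le> u' + 1 \<and> m \<le> s' + 1"
    proof (rule ccontr)
      assume no: "\<not> ?thesis"
      then have "u' \<le> m - 1" "s' \<le> m - 1" "w < m"
        using d less.prems(6) by auto
      then have "card A * u' \<le> card A * (m - 1)" "card B * s' \<le> card B * (m - 1)"
        by auto
      then have "m * m \<le> w * (m - 1) + m"
        unfolding tot[symmetric] w_def by (simp add: algebra_simps)
      moreover obtain h where h: "m = Suc h" using \<open>w < m\<close> by (cases m) auto
      ultimately have "Suc h * h \<le> w * h" by simp
      then have "0 < h \<longrightarrow> Suc h \<le> w" by (simp only: mult_le_cancel2)
      then have "h = 0" using \<open>w < m\<close> h by auto
      then show False using no h by auto
    qed
    \<comment> \<open>As \<open>d\<close> is odd, the odd and the even sum exchange their roles.\<close>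
    have "odd d" using d(1) by (simp add: w_def) presburger
    then have B: "packs {..<m} (\<lambda>i. const_on B s' i + const_on A u' i)"
      using less.prems d wn tot bound \<open>w \<noteq> 0\<close> by (intro less.IH) auto
    have cU: "2 * card (A \<union> B) = w"
      using less.prems(1-3) by (simp add: card_Un_disjoint w_def)
    have T: "packs ({m..<m + card (A \<union> B)} \<union> {m + card (A \<union> B)..<m + card (A \<union> B) + card (A \<union> B)})
        (const_on (A \<union> B) d)"
      using less.prems d cU by (intro packs_pairs) auto
    have "packs (({m..<m + card (A \<union> B)} \<union> {m + card (A \<union> B)..<m + card (A \<union> B) + card (A \<union> B)})
        \<union> {..<m}) (\<lambda>i. const_on (A \<union> B) d i + (const_on B s' i + const_on A u' i))"
      by (intro packs_add T B) auto
    moreover have "const_on (A \<union> B) d i + (const_on B s' i + const_on A u' i)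
        = const_on A u i + const_on B s i" for i
      using d less.prems(3) by (auto simp: const_on_def)
    moreover have "({m..<m + card (A \<union> B)} \<union> {m + card (A \<union> B)..<m + card (A \<union> B) + card (A \<union> B)})
        \<union> {..<m} \<subseteq> {..<n}"
      using d cU by auto
    ultimately show ?thesis
      by (auto elim!: packs_mono)
  qed
qed

section \<open>Balanced partitions of an initial interval\<close>

lemma balanced_partition:
  fixes n k :: nat
  assumes "k \<ge> 1" "2 * k \<le> n + 1"
  shows "\<exists>g \<in> {..<n} \<rightarrow> {1..k}. \<exists>a. \<forall>i \<in> {1..k}.
    a \<le> \<Sum>{x \<in> {..<n}. g x = i} \<and> \<Sum>{x \<in> {..<n}. g x = i} \<le> a + 1"
proof (cases "n + 1 = 2 * k")
  case True
  \<comment> \<open>Here the smaller of the two sums is \<open>n - 2\<close>, so the part \<open>{n - 1}\<close> has to be split off.\<close>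
  define t where "t i = (if i \<in> {1..k - 1} then n - 2 else if i = k then n - 1 else 0)" for i
  obtain h where h: "k = Suc h" using assms(1) by (cases k) auto
  then have n: "n = 2 * h + 1" using True by simp
  have "packs {..<2 * h} (const_on {1..h} (2 * h - 1))"
    using packs_equal[of "{1..h}" "{}" "2 * h - 1" "2 * h"] by (cases h) auto
  then have "packs {..<n} (const_on {1..h} (2 * h - 1))"
    by (rule packs_mono) (use n in auto)
  moreover have "sum t {1..k} = \<Sum>{..<n}"
  proof -
    have "sum t {1..k} = sum t {1..h} + t k" using h by simp
    also have "sum t {1..h} = (\<Sum>i \<in> {1..h}. 2 * h - 1)"
      using h n by (intro sum.cong) (auto simp: t_def)
    finally have "2 * sum t {1..k} + n = n * n"
      using h n by (cases h) (auto simp: t_def algebra_simps)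
    then show ?thesis using double_sum_lessThan[of n] by simp
  qed
  ultimately obtain g where "g \<in> {..<n} \<rightarrow> {1..k}"
    "\<And>i. i \<in> {1..k} \<Longrightarrow> \<Sum>{x \<in> {..<n}. g x = i} = t i"
    using packs_fill[of "{..<n}" "const_on {1..h} (2 * h - 1)" "{1..k}" k t] assms(1) h n
    by (auto simp: const_on_def t_def)
  then show ?thesis
    \<comment> \<open>For \<open>n = 1\<close> the bound \<open>n - 2\<close> truncates to 0, which
      is also the sum of the only part.\<close>
    by (intro bexI[of _ g] exI[of _ "n - 2"]) (auto simp: t_def)
next
  case False
  define a where "a = \<Sum>{..<n} div k"
  define v where "v = \<Sum>{..<n} mod k"
  define A where "A = {v<..k}"
  define B where "B = {1..v}"
  have v: "v < k" using assms(1) by (simp add: v_def)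
  have AB: "finite A" "finite B" "A \<inter> B = {}" "A \<union> B = {1..k}"
    using v by (auto simp: A_def B_def)
  have total: "card A * a + card B * (a + 1) = \<Sum>{..<n}"
  proof -
    have "card A * a + card B * (a + 1) = k * a + v"
      using v by (simp add: A_def B_def algebra_simps diff_mult_distrib)
    then show ?thesis by (simp add: a_def v_def)
  qed
  \<comment> \<open>Now \<open>2 * k \<le> n\<close>, so the average
    \<open>n * (n - 1) / (2 * k)\<close> is at least \<open>n - 1\<close>.\<close>
  have na: "n \<le> a + 1"
  proof -
    have "2 * k * (n - 1) \<le> n * (n - 1)" using False assms by (intro mult_le_mono1) auto
    also have "n * (n - 1) = 2 * \<Sum>{..<n}"
      using double_sum_lessThan[of n] by (simp add: diff_mult_distrib2)
    finally have "(n - 1) * k \<le> \<Sum>{..<n}" by (simp add: mult.commute)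
    then have "n - 1 \<le> a" using assms(1) by (simp add: a_def less_eq_div_iff_mult_less_eq)
    then show ?thesis by simp
  qed
  define t where "t i = const_on A a i + const_on B (a + 1) i" for i
  \<comment> \<open>Both orders are recorded because \<open>packs_nearly_equal\<close> takes the odd
    sum first.\<close>
  have t: "t = (\<lambda>i. const_on A a i + const_on B (a + 1) i)"
    "t = (\<lambda>i. const_on B (a + 1) i + const_on A a i)"
    by (auto simp: t_def)
  have "packs {..<n} t"
  proof (cases "odd a")
    case True
    then show ?thesis
      unfolding t(1) using AB na total double_sum_lessThan[of n]
      by (intro packs_nearly_equal) auto
  next
    case False
    then show ?thesis
      unfolding t(2) using AB na total double_sum_lessThan[of n]
      by (intro packs_nearly_equal) auto
  qed
  \<comment> \<open>The demands exhaust the sum of \<open>{..<n}\<close>, so at most the number 0 is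
    left over and label \<open>k\<close> can take it.\<close>
  then have "\<exists>g \<in> {..<n} \<rightarrow> {1..k}. \<forall>i \<in> {1..k}. \<Sum>{x \<in> {..<n}. g x = i} = t i"
  proof (rule packs_fill[where r = k])
    show "sum t {1..k} = \<Sum>{..<n}"
      using sum_const_on_add[OF AB(1-3), of a "a + 1"] total AB(4) by (simp add: t(1))
  qed (use assms(1) in auto)
  then obtain g where g: "g \<in> {..<n} \<rightarrow> {1..k}"
    "\<And>i. i \<in> {1..k} \<Longrightarrow> \<Sum>{x \<in> {..<n}. g x = i} = t i"
    by blast
  have "a \<le> t i \<and> t i \<le> a + 1" if "i \<in> {1..k}" for i
    using that AB(3,4) by (auto simp: t_def const_on_def)
  then show ?thesis using g by (intro bexI[of _ g] exI[of _ a]) auto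
qed

section \<open>From partitions to colorings\<close>

text \<open>The edges with larger endpoint \<open>x + 1\<close> are \<open>{y, x + 1}\<close> for
  \<open>y\<close> in \<open>{1..x}\<close>, hence \<open>x\<close> many. The shift by one matches
  the vertices \<open>{1..n}\<close> with the domain \<open>{..<n}\<close> of
  \<open>g\<close>.\<close>

lemma card_color_class_Max:
  "card (color_class n (\<lambda>e. g (Max e - 1)) i) = \<Sum>{x \<in> {..<n}. g x = i}"
proof -
  let ?S = "SIGMA x:{x \<in> {..<n}. g x = i}. {1..x}"
  have "bij_betw (\<lambda>(x, y). {y, x + 1}) ?S (color_class n (\<lambda>e. g (Max e - 1)) i)"
  proof (rule bij_betw_imageI)
    show "inj_on (\<lambda>(x, y). {y, x + 1}) ?S"
      by (auto simp: inj_on_def doubleton_eq_iff)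
    show "(\<lambda>(x, y). {y, x + 1}) ` ?S = color_class n (\<lambda>e. g (Max e - 1)) i"
    proof (intro equalityI subsetI)
      fix e assume "e \<in> (\<lambda>(x, y). {y, x + 1}) ` ?S"
      then show "e \<in> color_class n (\<lambda>e. g (Max e - 1)) i"
        by (auto simp: color_class_def complete_edges_def nsets_def max_def)
    next
      fix e assume "e \<in> color_class n (\<lambda>e. g (Max e - 1)) i"
      then have e: "e \<subseteq> {1..n}" "card e = 2" "g (Max e - 1) = i"
        by (auto simp: color_class_def complete_edges_def nsets_def)
      then obtain y z where "e = {y, z}" "y < z"
        by (metis card_2_iff insert_commute linorder_neqE_nat)
      then show "e \<in> (\<lambda>(x, y). {y, x + 1}) ` ?S"
        using e by (intro image_eqI[of _ _ "(z - 1, y)"]) (auto simp: max_def)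
    qed
  qed
  then have "card (color_class n (\<lambda>e. g (Max e - 1)) i) = card ?S"
    by (simp add: bij_betw_same_card)
  then show ?thesis by simp
qed

lemma gallai_coloring_Max:
  assumes "g \<in> {..<n} \<rightarrow> {1..k}"
  shows "gallai_coloring n k (\<lambda>e. g (Max e - 1))"
  unfolding gallai_coloring_def
proof (intro conjI ballI impI)
  show "(\<lambda>e. g (Max e - 1)) \<in> complete_edges n \<rightarrow> {1..k}"
  proof
    fix e assume "e \<in> complete_edges n"
    then have e: "e \<subseteq> {1..n}" "e \<noteq> {}" "finite e"
      by (auto simp: complete_edges_def nsets_def)
    then have "Max e \<in> {1..n}" using Max_in by blast
    then show "g (Max e - 1) \<in> {1..k}" using assms by (auto simp: Pi_iff)
  qed
qed (auto simp: max_def)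

lemma balanced_coloringI:
  assumes "k \<ge> 1" and "\<And>i. i \<in> {1..k} \<Longrightarrow> a \<le> card (color_class n c i)"
    and "\<And>i. i \<in> {1..k} \<Longrightarrow> card (color_class n c i) \<le> a + 1"
  shows "balanced_coloring n k c"
proof -
  let ?L = "class_sizes n k c"
  have set: "set ?L = (\<lambda>i. card (color_class n c i)) ` {1..k}"
    by (auto simp: class_sizes_def)
  then have "?L \<noteq> []" using assms(1) by force
  then have "hd ?L \<in> set ?L" "last ?L \<in> set ?L" by auto
  then have "hd ?L \<le> a + 1" "a \<le> last ?L"
    using assms(2,3) unfolding set by auto
  then show ?thesis by (simp add: balanced_coloring_def)
qed

theorem theorem3:
  fixes n k :: nat
  assumes "n \<ge> 1" and "k \<ge> 1" and "int k \<le> \<lceil>real n / 2\<rceil>"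
  shows "\<exists>c. gallai_coloring n k c \<and> balanced_coloring n k c"
proof -
  \<comment> \<open>The ceiling is below \<open>n / 2 + 1\<close>, so
    \<open>2 * k < n + 2\<close>.\<close>
  have "2 * k \<le> n + 1" using assms(3) by linarith
  then obtain g a where "g \<in> {..<n} \<rightarrow> {1..k}"
    "\<And>i. i \<in> {1..k} \<Longrightarrow>
      a \<le> \<Sum>{x \<in> {..<n}. g x = i} \<and> \<Sum>{x \<in> {..<n}. g x = i} \<le> a + 1"
    using balanced_partition[OF assms(2)] by blast
  then have "gallai_coloring n k (\<lambda>e. g (Max e - 1))" "balanced_coloring n k (\<lambda>e. g (Max e - 1))"
    using assms(2) by (auto intro!: gallai_coloring_Max balanced_coloringI[where a = a] simp del: One_nat_def simp: card_color_class_Max)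
  then show ?thesis by blast
qed

end
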